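(* Suppose the weights are symmetric, i.e. $(\Omega^{\omega})^\top=\Omega^{\omega}$. Then the $S$-flow $\dot S=R_S[\Omega^\omega S]$ on $\mathcal{W}$ is the Riemannian gradient descent flow $\dot S=-\operatorname{grad}J(S)$ induced by the potential $$J(S):=-\tfrac12\langle S,\Omega^\omega S\rangle,\qquad S\in\mathcal{W}.$$
   Context: $n,c\in\mathbb{N}$, $\mathcal{I}=\{1,\dots,n\}$, $\mathbf{1}_c=(1,\dots,1)^\top\in\mathbb{R}^c$. $\mathcal{S}=\{p\in\mathbb{R}^c : p_j>0\ \forall j,\ \langle \mathbf{1}_c,p\rangle=1\}$ has tangent space $T_0=\{v\in\mathbb{R}^c:\langle\mathbf{1}_c,v\rangle=0\}$ and carries the Fisher–Rao metric $g_p(u,v)=\sum_{j=1}^c u_jv_j/p_j$, $u,v\in T_0$. $\mathcal{W}=\mathcal{S}\times\dots\times\mathcal{S}$ ($n$ factors) carries the product metric and is identified with the matrices $S\in\mathbb{R}^{n\times c}$ with rows $S_i\in\mathcal{S}$; its tangent space is $\{V\in\mathbb{R}^{n\times c}:V\mathbf{1}_c=0\}$. $\operatorname{grad}J$ is the Riemannian gradient with respect to this metric. For $p\in\mathcal{S}$, $R_p=\operatorname{Diag}(p)-pp^\top:\mathbb{R}^c\to T_0$, and $R_S$ applies $R_{S_i}$ to the $i$-th row of a matrix in $\mathbb{R}^{n\times c}$, for each $i$. $\langle A,B\rangle=\operatorname{tr}(A^\top B)$ for matrices. $\mathcal{G}=(\mathcal{I},\mathcal{E})$ is an undirected graph, $\mathcal{N}_i=\{k\in\mathcal{I}: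 ik\in\mathcal{E}\}\cup\{i\}$ (so $k\in\mathcal{N}_i\Leftrightarrow i\in\mathcal{N}_k$). Weights satisfy $\omega_{ik}>0$ for $k\in\mathcal{N}_i$ and $\sum_{k\in\mathcal{N}_i}\omega_{ik}=1$ for every $i$. The averaging matrix $\Omega^\omega\in\mathbb{R}^{n\times n}$ has entries $\Omega^\omega_{ij}=\omega_{ij}$ if $j\in\mathcal{N}_i$ and $\Omega^\omega_{ij}=0$ otherwise. *)

theory Defs
  imports "HOL-Analysis.Analysis"
begin

text \<open>
  The unit \<open>1\<close> of type \<^typ>\<open>real^'c\<close> is the all-ones vector. A matrix with rows indexed
  by \<open>'n\<close> and columns by \<open>'c\<close> has type \<^typ>\<open>real^'c^'n\<close>.
\<close>

definition simplex_int :: "(real^'c) set" where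
  "simplex_int = {p. (\<forall>j. p $ j > 0) \<and> (1 :: real^'c) \<bullet> p = 1}"

definition fisher_rao :: "real^'c \<Rightarrow> real^'c \<Rightarrow> real^'c \<Rightarrow> real" where
  "fisher_rao p u v = (\<Sum>j\<in>UNIV. u $ j * v $ j / p $ j)"

definition assignment_manifold :: "(real^'c^'n) set" where
  "assignment_manifold = {S. \<forall>i. S $ i \<in> simplex_int}"

definition assignment_tangent :: "(real^'c^'n) set" where
  "assignment_tangent = {V. V *v (1 :: real^'c) = 0}"

definition assignment_metric :: "real^'c^'n \<Rightarrow> real^'c^'n \<Rightarrow> real^'c^'n \<Rightarrow> real" where
  "assignment_metric S U V = (\<Sum>i\<in>UNIV. fisher_rao (S $ i) (U $ i) (V $ i))"

text \<open>
  The assignment manifold is relatively open in an affine space directed by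
  \<^const>\<open>assignment_tangent\<close>. Hence a derivative within it, though not unique as a
  linear map on the ambient space, is uniquely determined on tangent vectors, where
  it is the differential of \<open>J\<close>.
\<close>

definition has_riem_grad :: "(real^'c^'n \<Rightarrow> real) \<Rightarrow> real^'c^'n \<Rightarrow> real^'c^'n \<Rightarrow> bool" where
  "has_riem_grad J S G \<longleftrightarrow> G \<in> assignment_tangent \<and>
     (\<exists>D. (J has_derivative D) (at S within assignment_manifold) \<and>
          (\<forall>V\<in>assignment_tangent. assignment_metric S G V = D V))"

definition riem_grad :: "(real^'c^'n \<Rightarrow> real) \<Rightarrow> real^'c^'n \<Rightarrow> real^'c^'n" where
  "riem_grad J S = (THE G. has_riem_grad J S G)"

definition replicator_matrix :: "real^'c \<Rightarrow> real^'c^'c" where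
  "replicator_matrix p = (\<chi> i j. if i = j then p $ i else 0) - (\<chi> i j. p $ i * p $ j)"

definition replicator :: "real^'c^'n \<Rightarrow> real^'c^'n \<Rightarrow> real^'c^'n" where
  "replicator S X = (\<chi> i. replicator_matrix (S $ i) *v (X $ i))"

definition mat_inner :: "real^'c^'n \<Rightarrow> real^'c^'n \<Rightarrow> real" where
  "mat_inner A B = trace (transpose A ** B)"

text \<open>
  An undirected graph is given by its symmetric adjacency relation. Loops are not
  excluded; they have no effect, since every vertex belongs to its own neighborhood.
\<close>

definition nbhd :: "('n \<times> 'n) set \<Rightarrow> 'n \<Rightarrow> 'n set" where
  "nbhd E i = {k. (i, k) \<in> E} \<union> {i}"

definition averaging_matrix :: "('n \<times> 'n) set \<Rightarrow> ('n \<Rightarrow> 'n \<Rightarrow> real) \<Rightarrow> real^'n^'n" where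
  "averaging_matrix E \<omega> = (\<chi> i j. if j \<in> nbhd E i then \<omega> i j else 0)"

definition flow_potential :: "real^'n^'n \<Rightarrow> real^'c^'n \<Rightarrow> real" where
  "flow_potential A S = - (1 / 2) * mat_inner S (A ** S)"

definition flow_curve :: "(real^'c^'n \<Rightarrow> real^'c^'n) \<Rightarrow> real set \<Rightarrow> (real \<Rightarrow> real^'c^'n) \<Rightarrow> bool" where
  "flow_curve F I \<gamma> \<longleftrightarrow> is_interval I \<and>
     (\<forall>t\<in>I. \<gamma> t \<in> assignment_manifold \<and> (\<gamma> has_vector_derivative F (\<gamma> t)) (at t within I))"

end

theory Submission
  imports Defs
begin

text \<open>
  The matrix \<open>R\<^sub>S\<close> converts Euclidean gradients into Riemannian ones: for a tangent
  vector \<open>V\<close>, the metric pairing of \<open>R\<^sub>S[X]\<close> with \<open>V\<close> is the Euclidean inner product of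
  \<open>X\<close> with \<open>V\<close>, because the term \<open>\<langle>p, x\<rangle>\<close> of \<open>R\<^sub>p x / p = x - \<langle>p, x\<rangle> 1\<close> is annihilated
  by tangent vectors. By symmetry of the averaging matrix, the Euclidean
  gradient of the potential at \<open>S\<close> is \<open>- \<Omega> S\<close>.
\<close>

lemma mat_inner_eq_inner: "mat_inner A B = A \<bullet> B"
proof -
  have "mat_inner A B = (\<Sum>j\<in>UNIV. \<Sum>i\<in>UNIV. A $ i $ j * B $ i $ j)"
    by (simp add: mat_inner_def trace_def matrix_matrix_mult_def transpose_def)
  also have "\<dots> = A \<bullet> B"
    by (subst sum.swap) (simp add: inner_vec_def)
  finally show ?thesis .
qed

text \<open>Both sides are the trace of \<open>transpose S ** transpose A ** T\<close>.\<close>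

lemma inner_matrix_mult_left:
  fixes A :: "real^'n^'m" and S :: "real^'c^'n" and T :: "real^'c^'m"
  shows "(A ** S) \<bullet> T = S \<bullet> (transpose A ** T)"
proof -
  have "(A ** S) \<bullet> T = trace (transpose (A ** S) ** T)"
    by (simp flip: mat_inner_eq_inner add: mat_inner_def)
  also have "\<dots> = S \<bullet> (transpose A ** T)"
    by (simp flip: mat_inner_eq_inner add: mat_inner_def matrix_transpose_mul matrix_mul_assoc)
  finally show ?thesis .
qed

lemma bounded_linear_matrix_mult_right:
  fixes A :: "real^'n^'m"
  shows "bounded_linear (\<lambda>S :: real^'c^'n. A ** S)"
  by (intro linear_conv_bounded_linear[THEN iffD1] linearI)
     (simp_all add: vec_eq_iff matrix_matrix_mult_def distrib_left sum.distrib
       sum_distrib_left mult.left_commute)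

text \<open>The product rule yields two terms. Symmetry of \<open>A\<close> makes them equal, which
  cancels the factor 1/2.\<close>

lemma has_derivative_flow_potential:
  fixes A :: "real^'n^'n" and S :: "real^'c^'n"
  assumes "transpose A = A"
  shows "(flow_potential A has_derivative (\<lambda>V. - ((A ** S) \<bullet> V))) (at S within M)"
proof -
  have "((\<lambda>S. - (1 / 2) * (S \<bullet> (A ** S))) has_derivative
          (\<lambda>V. - (1 / 2) * (S \<bullet> (A ** V) + V \<bullet> (A ** S)))) (at S within M)"
    by (intro has_derivative_mult_right has_derivative_inner has_derivative_ident
        bounded_linear.has_derivative[OF bounded_linear_matrix_mult_right])
  moreover have "S \<bullet> (A ** V) = (A ** S) \<bullet> V" for V
    using inner_matrix_mult_left[of A S V] assms by simp
  ultimately show ?thesis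
    by (simp add: flow_potential_def[abs_def] mat_inner_eq_inner inner_commute)
qed

lemma assignment_tangent_iff: "V \<in> assignment_tangent \<longleftrightarrow> (\<forall>i. (\<Sum>j\<in>UNIV. V $ i $ j) = 0)"
  by (simp add: assignment_tangent_def vec_eq_iff matrix_vector_mult_def)

lemma assignment_manifold_iff:
  "S \<in> assignment_manifold \<longleftrightarrow> (\<forall>i j. S $ i $ j > 0) \<and> (\<forall>i. (\<Sum>j\<in>UNIV. S $ i $ j) = 1)"
  by (auto simp: assignment_manifold_def simplex_int_def inner_vec_def)

text \<open>The factored form exposes \<open>S $ i $ j\<close>, which cancels against the
  denominator of the Fisher-Rao metric.\<close>

lemma replicator_nth:
  "replicator S X $ i $ j = S $ i $ j * (X $ i $ j - S $ i \<bullet> X $ i)"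
proof -
  have "replicator S X $ i $ j =
      (\<Sum>k\<in>UNIV. (if j = k then S $ i $ j * X $ i $ k else 0) - S $ i $ j * (S $ i $ k * X $ i $ k))"
    by (auto simp: replicator_def replicator_matrix_def matrix_vector_mult_def algebra_simps
        intro!: sum.cong)
  also have "\<dots> = S $ i $ j * (X $ i $ j - S $ i \<bullet> X $ i)"
    by (simp add: sum_subtractf inner_vec_def right_diff_distrib flip: sum_distrib_left)
  finally show ?thesis .
qed

lemma replicator_uminus: "replicator S (- X) = - replicator S X"
  by (simp add: vec_eq_iff replicator_nth algebra_simps)

text \<open>Row \<open>i\<close> of the image sums to \<langle>p, x\<rangle> - \<langle>p,
  x\<rangle> with p = \<open>S $ i\<close> and x = \<open>X $ i\<close>, since the entries of p sum
  to 1.\<close>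

lemma replicator_tangent:
  assumes "S \<in> assignment_manifold"
  shows "replicator S X \<in> assignment_tangent"
  using assms
  by (simp add: assignment_tangent_iff assignment_manifold_iff replicator_nth right_diff_distrib
      sum_subtractf inner_vec_def flip: sum_distrib_right)

lemma assignment_metric_replicator:
  assumes "S \<in> assignment_manifold" and "V \<in> assignment_tangent"
  shows "assignment_metric S (replicator S X) V = X \<bullet> V"
proof -
  have "fisher_rao (S $ i) (replicator S X $ i) (V $ i) = X $ i \<bullet> V $ i" for i
  proof -
    have pos: "S $ i $ j \<noteq> 0" for j
      using assms(1) by (metis assignment_manifold_iff less_irrefl)
    have "fisher_rao (S $ i) (replicator S X $ i) (V $ i) =
        (\<Sum>j\<in>UNIV. X $ i $ j * V $ i $ j) - (S $ i \<bullet> X $ i) * (\<Sum>j\<in>UNIV. V $ i $ j)"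
      by (simp add: fisher_rao_def replicator_nth pos left_diff_distrib sum_subtractf
          sum_distrib_left)
    also have "\<dots> = X $ i \<bullet> V $ i"
      using assms(2) by (simp add: assignment_tangent_iff inner_vec_def)
    finally show ?thesis .
  qed
  then show ?thesis
    by (simp add: assignment_metric_def inner_vec_def)
qed

lemma assignment_metric_diff_left:
  "assignment_metric S (U - U') V = assignment_metric S U V - assignment_metric S U' V"
  by (simp add: assignment_metric_def fisher_rao_def left_diff_distrib diff_divide_distrib
      sum_subtractf)

text \<open>The value is a sum of squares with positive weights \<open>1 / S $ i $ j\<close>, so
  every summand vanishes.\<close>

lemma assignment_metric_definite:
  assumes "S \<in> assignment_manifold" and "assignment_metric S V V = 0"
  shows "V = 0"
proof -
  have nonneg: "V $ i $ j * V $ i $ j / S $ i $ j \<ge> 0" for i j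
    using assms(1) by (simp add: assignment_manifold_iff less_imp_le)
  have "V $ i $ j * V $ i $ j / S $ i $ j = 0" for i j
    using assms(2) nonneg
    by (auto simp: assignment_metric_def fisher_rao_def sum_nonneg_eq_0_iff sum_nonneg)
  then show ?thesis
    using assms(1) by (simp add: vec_eq_iff assignment_manifold_iff) (metis less_irrefl)
qed

text \<open>Restricting \<open>f\<close> to the line through \<open>S\<close> in direction
  \<open>V\<close> reduces the claim to uniqueness of derivatives of functions of one real
  variable.\<close>

lemma derivative_within_manifold_unique:
  fixes S V :: "real^'c^'n"
  assumes S: "S \<in> assignment_manifold" and V: "V \<in> assignment_tangent"
    and D: "(f has_derivative D) (at S within assignment_manifold)"
    and D': "(f has_derivative D') (at S within assignment_manifold)"
  shows "D V = D' V"
proof -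
  \<comment> \<open>These are the parameters at which the line lies in the manifold: row sums stay 1
    because \<open>V\<close> is tangent. As a finite intersection of open sets, \<open>T\<close> is
    open, so the derivative at 0 within \<open>T\<close> is an ordinary one.\<close>
  define T where "T = {t :: real. \<forall>i j. S $ i $ j + t * V $ i $ j > 0}"
  have T: "open T" "0 \<in> T"
    using S unfolding T_def assignment_manifold_iff Collect_all_eq
    by (auto intro!: open_INT open_Collect_less continuous_intros)
  have sub: "(\<lambda>t. S + t *\<^sub>R V) ` T \<subseteq> assignment_manifold"
    using S V by (auto simp: T_def assignment_manifold_iff assignment_tangent_iff sum.distrib
        simp flip: sum_distrib_left)
  have "((\<lambda>t. f (S + t *\<^sub>R V)) has_derivative (\<lambda>t. L (t *\<^sub>R V))) (at 0)"
    if "(f has_derivative L) (at S within assignment_manifold)" for L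
  proof -
    have "((\<lambda>t. S + t *\<^sub>R V) has_derivative (\<lambda>t. t *\<^sub>R V)) (at 0 within T)"
      by (auto intro!: derivative_eq_intros)
    moreover have "(f has_derivative L) (at (S + 0 *\<^sub>R V) within (\<lambda>t. S + t *\<^sub>R V) ` T)"
      using has_derivative_subset[OF that sub] by simp
    ultimately have "((\<lambda>t. f (S + t *\<^sub>R V)) has_derivative (\<lambda>t. L (t *\<^sub>R V))) (at 0 within T)"
      by (rule has_derivative_in_compose)
    then show ?thesis
      by (simp add: at_within_open[OF T(2,1)])
  qed
  \<comment> \<open>The maps \<open>t \<mapsto> D (t *\<^sub>R V)\<close> and
    \<open>t \<mapsto> D' (t *\<^sub>R V)\<close> agree; evaluate at t = 1.\<close>
  from has_derivative_unique[OF this[OF D] this[OF D']] show ?thesis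
    by (metis scaleR_one)
qed

text \<open>The two gradients may come with different derivatives, but these agree on the tangent
  vector \<open>G - G'\<close>, which therefore has squared length 0.\<close>

lemma has_riem_grad_unique:
  assumes S: "S \<in> assignment_manifold" and G: "has_riem_grad f S G" and G': "has_riem_grad f S G'"
  shows "G = G'"
proof -
  from G G' obtain D D'
    where D: "(f has_derivative D) (at S within assignment_manifold)"
        "\<And>V. V \<in> assignment_tangent \<Longrightarrow> assignment_metric S G V = D V"
      and D': "(f has_derivative D') (at S within assignment_manifold)"
        "\<And>V. V \<in> assignment_tangent \<Longrightarrow> assignment_metric S G' V = D' V"
    unfolding has_riem_grad_def by blast
  have tangent: "G - G' \<in> assignment_tangent"
    using G G' by (simp add: has_riem_grad_def assignment_tangent_iff sum_subtractf)
  have "assignment_metric S (G - G') (G - G') = 0"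
    using derivative_within_manifold_unique[OF S tangent D(1) D'(1)]
    by (simp add: assignment_metric_diff_left D(2)[OF tangent] D'(2)[OF tangent])
  from assignment_metric_definite[OF S this] show ?thesis by simp
qed

lemma riem_grad_eqI:
  assumes "S \<in> assignment_manifold" and "has_riem_grad f S G"
  shows "riem_grad f S = G"
  unfolding riem_grad_def using assms by (blast intro: has_riem_grad_unique)

lemma has_riem_grad_replicator:
  assumes "S \<in> assignment_manifold"
    and "(f has_derivative (\<lambda>V. X \<bullet> V)) (at S within assignment_manifold)"
  shows "has_riem_grad f S (replicator S X)"
  unfolding has_riem_grad_def
  using assms replicator_tangent assignment_metric_replicator by blast

theorem proposition3p8:
  fixes E :: "('n::finite \<times> 'n) set" and \<omega> :: "'n \<Rightarrow> 'n \<Rightarrow> real"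
    and \<Omega> :: "real^'n^'n" and J :: "real^'c::finite^'n \<Rightarrow> real"
  defines "\<Omega> \<equiv> averaging_matrix E \<omega>"
    and "J \<equiv> flow_potential \<Omega>"
  assumes "sym E"
    and "\<And>i k. k \<in> nbhd E i \<Longrightarrow> \<omega> i k > 0"
    and "\<And>i. (\<Sum>k\<in>nbhd E i. \<omega> i k) = 1"
    and "transpose \<Omega> = \<Omega>"
  shows "(\<forall>S\<in>assignment_manifold.
            has_riem_grad J S (riem_grad J S) \<and>
            replicator S (\<Omega> ** S) = - riem_grad J S) \<and>
         (\<forall>I \<gamma>. flow_curve (\<lambda>S. replicator S (\<Omega> ** S)) I \<gamma> \<longleftrightarrow>
                flow_curve (\<lambda>S. - riem_grad J S) I \<gamma>)"
proof -
  \<comment> \<open>The Euclidean gradient here is \<open>- (\<Omega> ** S)\<close>; linearity of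
    the replicator map moves the sign outside.\<close>
  have grad: "has_riem_grad J S (- replicator S (\<Omega> ** S))" if "S \<in> assignment_manifold" for S
    using has_riem_grad_replicator[OF that, of J "- (\<Omega> ** S)"]
      has_derivative_flow_potential[OF \<open>transpose \<Omega> = \<Omega>\<close>, of S assignment_manifold]
    by (simp add: J_def replicator_uminus)
  have eq: "riem_grad J S = - replicator S (\<Omega> ** S)" if "S \<in> assignment_manifold" for S
    using riem_grad_eqI[OF that grad[OF that]] .
  \<comment> \<open>Flow curves stay in the manifold by definition, so equality of the two vector
    fields there suffices.\<close>
  show ?thesis
    by (auto simp: eq grad flow_curve_def)
qed

end
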